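(* Let $m,n$ be positive integers, let $\alpha\ge1$, $x>0$, and $\lambda_{ij}>0$ for $1\le i\le m$ and $1\le j\le n$. Denote $\nu_i=\sum_{j=1}^n\lambda_{ij}$ and $\tau_j=\sum_{i=1}^m\lambda_{ij}$. Then $$\sum_{i=1}^m\frac{\nu_i^{\alpha-1}}{e^{x/\nu_i}-1}+\sum_{j=1}^n\frac{\tau_j^{\alpha-1}}{e^{x/\tau_j}-1}\ge2\sum_{i=1}^m\sum_{j=1}^n\frac{\lambda_{ij}^{\alpha-1}}{e^{x/\lambda_{ij}}-1}.$$ *)

theory Defs
  imports Complex_Main
begin

end

theory Submission imports Defs begin

text \<open>The function \<open>f t = t powr (\<alpha> - 1) / (exp (x / t) - 1)\<close> has the form \<open>t * g t\<close> with \<open>g\<close>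
increasing on the positive reals, because \<open>t * (exp (x / t) - 1)\<close> decreases in \<open>t\<close> by
convexity of \<open>exp\<close>. Hence \<open>f\<close> is superadditive, and applying this to every row and every
column of \<open>lam\<close> bounds each of the two sums on the left by the double sum.\<close>

text \<open>Positivity puts each \<open>a j\<close> below the total, so \<open>g (a j)\<close> is at
  most \<open>g (sum a A)\<close>; weighting by \<open>a j\<close> and summing gives the
  claim.\<close>

lemma superadditive_of_mono_quotient:
  fixes a :: "'a \<Rightarrow> real" and g :: "real \<Rightarrow> real"
  assumes "finite A" and "mono_on {0<..} g" and pos: "\<And>j. j \<in> A \<Longrightarrow> a j > 0"
  shows "(\<Sum>j\<in>A. a j * g (a j)) \<le> sum a A * g (sum a A)"
  unfolding sum_distrib_right
proof (rule sum_mono)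
  fix j assume j: "j \<in> A"
  have le: "a j \<le> sum a A"
    by (rule member_le_sum) (use assms j in \<open>auto intro: less_imp_le\<close>)
  with pos[OF j] have "g (a j) \<le> g (sum a A)"
    by (intro mono_onD[OF assms(2)]) auto
  with pos[OF j] show "a j * g (a j) \<le> a j * g (sum a A)" by simp
qed

text \<open>Convexity of \<open>exp\<close>: its chord slope from 0, \<open>(exp t - 1) / t\<close>,
  increases in \<open>t\<close>; denominators are cleared here. The tangent at \<open>a\<close> lies
  below \<open>exp\<close> at \<open>b\<close> and at 0, and these two bounds are added with weights
  \<open>a\<close> and \<open>b - a\<close>.\<close>

lemma exp_minus_one_slope_mono:
  fixes a b :: real
  assumes "0 < a" "a \<le> b"
  shows "b * (exp a - 1) \<le> a * (exp b - 1)"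
proof -
  have "exp a * (1 + (b - a)) \<le> exp a * exp (b - a)"
    by (intro mult_left_mono exp_ge_add_one_self) simp
  then have "a * (exp a * (1 + (b - a))) \<le> a * exp b"
    using assms by (simp flip: exp_add)
  moreover have "exp a * (1 + - a) \<le> exp a * exp (- a)"
    by (intro mult_left_mono exp_ge_add_one_self) simp
  then have "(b - a) * (exp a * (1 - a)) \<le> (b - a) * 1"
    using assms by (intro mult_left_mono) (simp_all flip: exp_add)
  ultimately show ?thesis by (simp add: algebra_simps)
qed

lemma mono_on_powr_over_exp_quotient:
  fixes \<alpha> x :: real
  assumes "\<alpha> \<ge> 1" "x > 0"
  shows "mono_on {0<..} (\<lambda>t. t powr (\<alpha> - 1) / (t * (exp (x / t) - 1)))"
proof (rule mono_onI)
  fix s t :: real assume "s \<in> {0<..}" "t \<in> {0<..}" "s \<le> t"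
  then have st: "0 < s" "0 < t" "s \<le> t" by auto
  \<comment> \<open>The slope bound is used at \<open>x / t \<le> x / s\<close>: inverting the
    argument turns growth in \<open>x / t\<close> into decrease in \<open>t\<close>.\<close>
  have "x / s * (exp (x / t) - 1) \<le> x / t * (exp (x / s) - 1)"
    using st assms by (intro exp_minus_one_slope_mono) (auto intro: divide_left_mono)
  then have "t * (exp (x / t) - 1) \<le> s * (exp (x / s) - 1)"
    using st assms by (simp add: divide_simps mult.commute)
  \<comment> \<open>The numerator grows since \<open>\<alpha> \<ge> 1\<close>, while the denominator
    shrinks and stays positive.\<close>
  then show "s powr (\<alpha> - 1) / (s * (exp (x / s) - 1)) \<le> t powr (\<alpha> - 1) / (t * (exp (x / t) - 1))"
    using st assms by (intro frac_le powr_mono2 mult_pos_pos) auto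
qed

lemma superadditive_powr_over_exp:
  fixes a :: "'a \<Rightarrow> real" and \<alpha> x :: real
  assumes "finite A" "A \<noteq> {}" "\<alpha> \<ge> 1" "x > 0" and pos: "\<And>j. j \<in> A \<Longrightarrow> a j > 0"
  shows "(\<Sum>j\<in>A. a j powr (\<alpha> - 1) / (exp (x / a j) - 1))
       \<le> sum a A powr (\<alpha> - 1) / (exp (x / sum a A) - 1)"
proof -
  \<comment> \<open>Positivity of the total lets the factor \<open>sum a A\<close> cancel on the
    right, as \<open>a j\<close> does in each term on the left.\<close>
  have "sum a A > 0" using assms by (intro sum_pos) auto
  moreover have "(\<Sum>j\<in>A. a j powr (\<alpha> - 1) / (exp (x / a j) - 1))
      = (\<Sum>j\<in>A. a j * (a j powr (\<alpha> - 1) / (a j * (exp (x / a j) - 1))))"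
    using pos by (intro sum.cong) force+
  ultimately show ?thesis
    using superadditive_of_mono_quotient[OF assms(1) mono_on_powr_over_exp_quotient[OF assms(3,4)], of a] assms(1) pos
    by simp
qed

theorem theorem4p1:
  fixes m n :: nat and \<alpha> x :: real
    and lam :: "nat \<Rightarrow> nat \<Rightarrow> real" and \<nu> \<tau> :: "nat \<Rightarrow> real"
  assumes "m \<ge> 1" and "n \<ge> 1"
    and "\<alpha> \<ge> 1" and "x > 0"
    and "\<And>i j. i \<in> {1..m} \<Longrightarrow> j \<in> {1..n} \<Longrightarrow> lam i j > 0"
    and "\<And>i. i \<in> {1..m} \<Longrightarrow> \<nu> i = (\<Sum>j=1..n. lam i j)"
    and "\<And>j. j \<in> {1..n} \<Longrightarrow> \<tau> j = (\<Sum>i=1..m. lam i j)"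
  shows "(\<Sum>i=1..m. \<nu> i powr (\<alpha> - 1) / (exp (x / \<nu> i) - 1))
       + (\<Sum>j=1..n. \<tau> j powr (\<alpha> - 1) / (exp (x / \<tau> j) - 1))
       \<ge> 2 * (\<Sum>i=1..m. \<Sum>j=1..n. lam i j powr (\<alpha> - 1) / (exp (x / lam i j) - 1))"
proof -
  let ?f = "\<lambda>t. t powr (\<alpha> - 1) / (exp (x / t) - 1)"
  have "(\<Sum>i=1..m. \<Sum>j=1..n. ?f (lam i j)) \<le> (\<Sum>i=1..m. ?f (\<nu> i))"
  proof (rule sum_mono)
    fix i assume i: "i \<in> {1..m}"
    show "(\<Sum>j=1..n. ?f (lam i j)) \<le> ?f (\<nu> i)"
      unfolding assms(6)[OF i]
      by (rule superadditive_powr_over_exp) (use assms(2-5) i in auto)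
  qed
  moreover have "(\<Sum>j=1..n. \<Sum>i=1..m. ?f (lam i j)) \<le> (\<Sum>j=1..n. ?f (\<tau> j))"
  proof (rule sum_mono)
    fix j assume j: "j \<in> {1..n}"
    show "(\<Sum>i=1..m. ?f (lam i j)) \<le> ?f (\<tau> j)"
      unfolding assms(7)[OF j]
      by (rule superadditive_powr_over_exp) (use assms(1,3-5) j in auto)
  qed
  moreover have "(\<Sum>j=1..n. \<Sum>i=1..m. ?f (lam i j)) = (\<Sum>i=1..m. \<Sum>j=1..n. ?f (lam i j))"
    by (rule sum.swap)
  ultimately show ?thesis by linarith
qed

end
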